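(* Let $P_0,P_1$ be distributions with $\Delta(\ell)<\infty$, let $\epsilon>0$, $n\ge1$, and $T\in\mathbb{R}$. Then the randomized algorithm $X\mapsto\mathrm{OnlinePCPD}(X,P_0,P_1,\epsilon,n,T)$ is $(\epsilon,0)$-differentially private for arbitrary data $X$. That is, for every pair of neighboring data streams $X,X'$ and every (measurable) set $\mathcal{S}$ of possible output sequences, $$\Pr[\mathrm{OnlinePCPD}(X,P_0,P_1,\epsilon,n,T)\in\mathcal{S}]\le e^{\epsilon}\,\Pr[\mathrm{OnlinePCPD}(X',P_0,P_1,\epsilon,n,T)\in\mathcal{S}].$$
   Context: $P_0,P_1$ are probability distributions on $\mathbb{R}$, and $P_0(x),P_1(x)$ denote their densities (or mass functions) with respect to a common reference measure. $\log$ is the natural logarithm, with the convention $\log\frac00=0$. A data stream is a sequence $X=\{x_1,x_2,\dots\}$ of reals; two streams are neighboring if they differ in at most one entry. The sensitivity is $$\Delta(\ell)=\max_{x\in\mathbb{R}}\log\frac{P_1(x)}{P_0(x)}-\min_{x'\in\mathbb{R}}\log\frac{P_1(x')}{P_0(x')}$$ (max/min are read as supremum/infimum if not attained). $\mathrm{Lap}(b)$ is the Laplace distribution with density $\frac1{2b}e^{-|x|/b}$ (for $b=0$, the point mass at $0$). All Laplace draws below are independent. Algorithm $\mathrm{OfflinePCPD}(Y,P_0,P_1,\epsilon',0,n)$ on $Y=\{y_1,\dots,y_n\}$: let $A=\Delta(\ell)$; draw $Z_1,\dots,Z_n$ i.i.d. from $\mathrm{Lap}(A/\epsilon')$; output $\mathrm{argmax}_{1\le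 k\le n}\left\{\sum_{i=k}^n\log\frac{P_1(y_i)}{P_0(y_i)}+Z_k\right\}$ (ties, if any, broken by a fixed rule). Algorithm $\mathrm{OnlinePCPD}(X,P_0,P_1,\epsilon,n,T)$: let $A=\Delta(\ell)$ and draw $\hat T=T+\mathrm{Lap}(4A/\epsilon)$ once. For each new data point $x_j$, $j=n,n+1,\dots$: compute $\ell_j=\max_{j-n+1\le k\le j}\sum_{i=k}^j\log\frac{P_1(x_i)}{P_0(x_i)}$; sample $Z_j\sim\mathrm{Lap}(8A/\epsilon)$; if $\ell_j+Z_j>\hat T$, output $\mathrm{OfflinePCPD}(\{x_{j-n+1},\dots,x_j\},P_0,P_1,\epsilon/2,0,n)+(j-n)$ (run with fresh randomness) and halt; otherwise output $\bot$ and continue. The output of the algorithm is the whole sequence of symbols it outputs. *)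

theory Defs
  imports "HOL-Probability.Probability"
begin

(* Log-likelihood ratio with log (0/0) = 0.  It is ereal-valued because ln 0 = 0 and x / 0 = 0
   in HOL would otherwise hide the infinite ratios from the sensitivity. *)
definition llr :: "(real \<Rightarrow> real) \<Rightarrow> (real \<Rightarrow> real) \<Rightarrow> real \<Rightarrow> ereal" where
  "llr p0 p1 x =
     (if p0 x = 0 then (if p1 x = 0 then 0 else \<infinity>)
      else if p1 x = 0 then -\<infinity>
      else ereal (ln (p1 x / p0 x)))"

definition sensitivity :: "(real \<Rightarrow> real) \<Rightarrow> (real \<Rightarrow> real) \<Rightarrow> ereal" where
  "sensitivity p0 p1 = (SUP x. llr p0 p1 x) - (INF x. llr p0 p1 x)"

(* For probability densities, finite sensitivity forces llr p0 p1 x to be finite for every x,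
   so in that case real_of_ereal only changes the type. *)
definition llr_sum :: "(real \<Rightarrow> real) \<Rightarrow> (real \<Rightarrow> real) \<Rightarrow> (nat \<Rightarrow> real) \<Rightarrow> nat \<Rightarrow> nat \<Rightarrow> real" where
  "llr_sum p0 p1 x k j = (\<Sum>i=k..j. real_of_ereal (llr p0 p1 (x i)))"

definition laplace :: "real \<Rightarrow> real measure" where
  "laplace b =
     (if b = 0 then return borel 0
      else density lborel (\<lambda>x. ennreal (exp (- \<bar>x\<bar> / b) / (2 * b))))"

(* The data are y 1, ..., y n.  The argument tie is the fixed rule that selects one of the
   maximisers. *)
definition offline_pcpd ::
  "(nat set \<Rightarrow> nat) \<Rightarrow> (nat \<Rightarrow> real) \<Rightarrow> (real \<Rightarrow> real) \<Rightarrow> (real \<Rightarrow> real) \<Rightarrow> real \<Rightarrow> nat \<Rightarrow> nat measure" where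
  "offline_pcpd tie y p0 p1 \<epsilon> n =
     (let A = real_of_ereal (sensitivity p0 p1) in
      distr (\<Pi>\<^sub>M k\<in>{1..n}. laplace (A / \<epsilon>)) (count_space UNIV)
        (\<lambda>Z. tie {k. is_arg_max (\<lambda>k. llr_sum p0 p1 y k n + Z k) (\<lambda>k. k \<in> {1..n}) k}))"

datatype symbol = Bot | Location nat

(* A finite or infinite output sequence, indexed by time: the value at j is the symbol output at
   time j, and None when there is none (j < n, or the algorithm has halted). *)
type_synonym transcript = "nat \<Rightarrow> symbol option"

definition halted_transcript :: "nat \<Rightarrow> nat \<Rightarrow> nat \<Rightarrow> transcript" where
  "halted_transcript n j v =
     (\<lambda>i. if n \<le> i \<and> i < j then Some Bot else if i = j then Some (Location v) else None)"

definition endless_transcript :: "nat \<Rightarrow> transcript" where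
  "endless_transcript n = (\<lambda>i. if n \<le> i then Some Bot else None)"

definition window_max :: "(real \<Rightarrow> real) \<Rightarrow> (real \<Rightarrow> real) \<Rightarrow> nat \<Rightarrow> (nat \<Rightarrow> real) \<Rightarrow> nat \<Rightarrow> real" where
  "window_max p0 p1 n x j = Max ((\<lambda>k. llr_sum p0 p1 x k j) ` {j - n + 1..j})"

(* The law of the output on the stream x 1, x 2, ... (x 0 is not used).  The noise is the pair of
   the threshold noise W and the family of the Z j for j >= n, drawn up front.  Only countably many
   transcripts can occur, so the discrete sigma-algebra on transcripts loses no events. *)
definition online_pcpd ::
  "(nat set \<Rightarrow> nat) \<Rightarrow> (nat \<Rightarrow> real) \<Rightarrow> (real \<Rightarrow> real) \<Rightarrow> (real \<Rightarrow> real) \<Rightarrow> real \<Rightarrow> nat \<Rightarrow> real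
     \<Rightarrow> transcript measure" where
  "online_pcpd tie x p0 p1 \<epsilon> n T =
     (let A = real_of_ereal (sensitivity p0 p1) in
      (laplace (4 * A / \<epsilon>) \<Otimes>\<^sub>M (\<Pi>\<^sub>M j\<in>{n..}. laplace (8 * A / \<epsilon>))) \<bind>
        (\<lambda>(W, Z).
          let fires = (\<lambda>j. n \<le> j \<and> window_max p0 p1 n x j + Z j > T + W) in
          if \<exists>j. fires j
          then let j = (LEAST j. fires j) in
            offline_pcpd tie (\<lambda>i. x (j - n + i)) p0 p1 (\<epsilon> / 2) n \<bind>
              (\<lambda>k. return (count_space UNIV) (halted_transcript n j (k + (j - n))))
          else return (count_space UNIV) (endless_transcript n)))"

definition neighboring :: "(nat \<Rightarrow> real) \<Rightarrow> (nat \<Rightarrow> real) \<Rightarrow> bool" where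
  "neighboring x x' \<longleftrightarrow> (\<exists>j. \<forall>i\<ge>1. i \<noteq> j \<longrightarrow> x i = x' i)"

definition differentially_private ::
  "('a \<Rightarrow> 'a \<Rightarrow> bool) \<Rightarrow> ('a \<Rightarrow> 'b measure) \<Rightarrow> real \<Rightarrow> real \<Rightarrow> bool" where
  "differentially_private nb M \<epsilon> \<delta> \<longleftrightarrow>
     (\<forall>x x'. nb x x' \<longrightarrow>
        (\<forall>S\<in>sets (M x). measure (M x) S \<le> exp \<epsilon> * measure (M x') S + \<delta>))"

end

theory Submission
  imports Defs
begin

text \<open>Changing one data point moves every window maximum by at most the sensitivity \<open>A\<close>.  Hence, if the
  first alarm is at time \<open>j\<close> on one stream, it is also at time \<open>j\<close> on the other one after the threshold
  noise is raised by \<open>A\<close> and \<open>Z j\<close> by \<open>2 * A\<close>; translating the Laplace variables costs a factor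
  \<open>exp (\<epsilon> / 4)\<close> each.  In the offline stage the output \<open>k\<close> is preserved by raising \<open>Z k\<close> by slightly
  more than \<open>A\<close>, which costs the remaining factor \<open>exp (\<epsilon> / 2)\<close>.  If \<open>A = 0\<close>, the noise degenerates to
  point masses, but then the log-likelihood ratio is constant and the output does not depend on the
  data.\<close>

section \<open>Comparison of discrete measures up to a constant factor\<close>

text \<open>On a countable type both measures are sums of their point masses, so a multiplicative
  privacy bound can be checked on single outcomes.\<close>

lemma emeasure_le_if_singletons_le:
  fixes M N :: "'a :: countable measure"
  assumes M: "sets M = UNIV" and N: "sets N = UNIV"
    and le: "\<And>a. emeasure M {a} \<le> c * emeasure N {a}"
  shows "emeasure M S \<le> c * emeasure N S"
proof -
  have "emeasure M S = (\<integral>\<^sup>+a. emeasure M {a} \<partial>count_space S)"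
    using M by (intro emeasure_countable_singleton) auto
  also have "\<dots> \<le> (\<integral>\<^sup>+a. c * emeasure N {a} \<partial>count_space S)"
    by (intro nn_integral_mono le)
  also have "\<dots> = c * (\<integral>\<^sup>+a. emeasure N {a} \<partial>count_space S)"
    by (rule nn_integral_cmult) simp
  also have "\<dots> = c * emeasure N S"
    using N by (subst emeasure_countable_singleton) auto
  finally show ?thesis .
qed

text \<open>The setwise bound says \<open>M \<le> scale_measure c N\<close>, and integrals are
  monotone in the measure. With \<open>f a\<close> the probability of an event given the outcome
  \<open>a\<close>, this carries the factor \<open>c\<close> through any further processing of the
  outcome.\<close>

lemma nn_integral_le_if_singletons_le:
  fixes M N :: "'a :: countable measure"
  assumes M: "sets M = UNIV" and N: "sets N = UNIV"
    and le: "\<And>a. emeasure M {a} \<le> c * emeasure N {a}"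
  shows "(\<integral>\<^sup>+a. f a \<partial>M) \<le> c * (\<integral>\<^sup>+a. f a \<partial>N)"
proof -
  have f: "f \<in> borel_measurable N"
    using N by (simp add: measurable_def)
  have "M \<le> scale_measure c N"
    using M N emeasure_le_if_singletons_le[OF assms] by (subst le_measure) auto
  then have "(\<integral>\<^sup>+a. f a \<partial>M) \<le> (\<integral>\<^sup>+a. f a \<partial>scale_measure c N)"
    using M N by (intro nn_integral_mono_measure) auto
  also have "\<dots> = c * (\<integral>\<^sup>+a. f a \<partial>N)"
    by (rule nn_integral_scale_measure[OF f])
  finally show ?thesis .
qed

section \<open>The Laplace distribution and the cost of translating it\<close>

lemma sets_laplace [simp, measurable_cong]: "sets (laplace b) = sets borel"
  by (simp add: laplace_def)

lemma space_laplace [simp]: "space (laplace b) = UNIV"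
  by (simp add: laplace_def)

lemma nn_integral_laplace:
  assumes "b > 0" and [measurable]: "f \<in> borel_measurable borel"
  shows "(\<integral>\<^sup>+x. f x \<partial>laplace b)
    = (\<integral>\<^sup>+x. ennreal (exp (- \<bar>x\<bar> / b) / (2 * b)) * f x \<partial>lborel)"
  using assms(1) unfolding laplace_def by (simp add: nn_integral_density)

text \<open>Almost everywhere, the Laplace density is the mean of an exponential density and its
  reflection, both of integral 1.\<close>

lemma prob_space_laplace:
  assumes "b > 0"
  shows "prob_space (laplace b)"
proof -
  let ?e = "\<lambda>x. ennreal (exponential_density (1 / b) x)"
  have e: "(\<integral>\<^sup>+x. ?e x \<partial>lborel) = 1"
    using prob_space.emeasure_space_1[OF prob_space_exponential_density[of "1 / b"]] assms
    by (simp add: emeasure_density)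
  have "emeasure (laplace b) (space (laplace b))
    = (\<integral>\<^sup>+x. ennreal (exp (- \<bar>x\<bar> / b) / (2 * b)) \<partial>lborel)"
    using nn_integral_laplace[OF assms, of "\<lambda>_. 1"] by simp
  also have "\<dots> = (\<integral>\<^sup>+x. ennreal (1 / 2) * (?e x + ?e (- x)) \<partial>lborel)"
  proof (rule nn_integral_cong_AE)
    \<comment> \<open>At 0 both exponential densities are positive and their mean is twice the
      Laplace density, so this null set has to be left out.\<close>
    have "AE x in lborel. x \<noteq> (0 :: real)"
      by (rule AE_lborel_singleton)
    then show "AE x in lborel. ennreal (exp (- \<bar>x\<bar> / b) / (2 * b))
      = ennreal (1 / 2) * (?e x + ?e (- x))"
    proof (rule eventually_mono)
      fix x :: real assume "x \<noteq> 0"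
      then have "exp (- \<bar>x\<bar> / b) / (2 * b)
        = 1 / 2 * (exponential_density (1 / b) x + exponential_density (1 / b) (- x))"
        using assms by (auto simp: exponential_density_def)
      then show "ennreal (exp (- \<bar>x\<bar> / b) / (2 * b)) = ennreal (1 / 2) * (?e x + ?e (- x))"
        using assms ennreal_mult'[of "1 / 2"]
        by (simp only: ennreal_plus[symmetric] exponential_density_nonneg zero_less_divide_1_iff)
    qed
  qed
  also have "\<dots> = ennreal (1 / 2) * ((\<integral>\<^sup>+x. ?e x \<partial>lborel) + (\<integral>\<^sup>+x. ?e (- x) \<partial>lborel))"
    by (simp add: nn_integral_cmult nn_integral_add)
  also have "(\<integral>\<^sup>+x. ?e (- x) \<partial>lborel) = 1"
    using e nn_integral_real_affine[of ?e "- 1" 0] by simp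
  also have "ennreal (1 / 2) * ((\<integral>\<^sup>+x. ?e x \<partial>lborel) + 1) = ennreal (1 / 2) * ennreal 2"
    unfolding e by simp
  also have "\<dots> = 1"
    by (subst ennreal_mult[symmetric]) auto
  finally show ?thesis
    by (rule prob_spaceI)
qed

text \<open>Substitution moves the translation from \<open>f\<close> into the density, and the
  triangle inequality \<open>\<bar>x\<bar> \<le> \<bar>x - c\<bar> + \<bar>c\<bar>\<close> bounds
  the ratio of the two densities by \<open>exp (\<bar>c\<bar> / b)\<close>.\<close>

lemma nn_integral_laplace_shift_le:
  assumes b: "b > 0" and f [measurable]: "f \<in> borel_measurable borel"
  shows "(\<integral>\<^sup>+x. f (x + c) \<partial>laplace b) \<le> exp (\<bar>c\<bar> / b) * (\<integral>\<^sup>+x. f x \<partial>laplace b)"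
proof -
  let ?d = "\<lambda>x. exp (- \<bar>x\<bar> / b) / (2 * b)"
  have d: "?d (x - c) \<le> exp (\<bar>c\<bar> / b) * ?d x" for x
  proof -
    have "- \<bar>x - c\<bar> / b \<le> \<bar>c\<bar> / b + (- \<bar>x\<bar> / b)"
      using b by (simp add: field_simps)
    then have "exp (- \<bar>x - c\<bar> / b) \<le> exp (\<bar>c\<bar> / b) * exp (- \<bar>x\<bar> / b)"
      by (simp flip: exp_add)
    then show ?thesis
      using b by (simp add: divide_right_mono)
  qed
  have "(\<integral>\<^sup>+x. f (x + c) \<partial>laplace b) = (\<integral>\<^sup>+x. ennreal (?d x) * f (x + c) \<partial>lborel)"
    using b by (intro nn_integral_laplace) auto
  also have "\<dots> = (\<integral>\<^sup>+x. ennreal (?d (x - c)) * f x \<partial>lborel)"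
    using nn_integral_real_affine[of "\<lambda>x. ennreal (?d (x - c)) * f x" 1 c]
    by (simp add: add.commute)
  also have "\<dots> \<le> (\<integral>\<^sup>+x. ennreal (exp (\<bar>c\<bar> / b)) * (ennreal (?d x) * f x) \<partial>lborel)"
  proof (rule nn_integral_mono)
    fix x
    have "ennreal (?d (x - c)) \<le> ennreal (exp (\<bar>c\<bar> / b)) * ennreal (?d x)"
      using ennreal_leI[OF d[of x]] by (simp only: ennreal_mult' exp_ge_zero)
    then show "ennreal (?d (x - c)) * f x \<le> ennreal (exp (\<bar>c\<bar> / b)) * (ennreal (?d x) * f x)"
      by (simp add: mult_right_mono flip: mult.assoc)
  qed
  also have "\<dots> = exp (\<bar>c\<bar> / b) * (\<integral>\<^sup>+x. f x \<partial>laplace b)"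
    using b by (simp add: nn_integral_cmult nn_integral_laplace)
  finally show ?thesis .
qed

text \<open>Fubini for one coordinate against all others. The index set may be infinite, as it is
  for the noise \<open>Z j\<close> with \<open>j \<ge> n\<close> of the online stage.\<close>

lemma nn_integral_PiM_insert:
  assumes M: "\<And>i. i \<in> I \<Longrightarrow> prob_space (M i)" and k: "k \<in> I"
    and f: "f \<in> borel_measurable (PiM I M)"
  shows "(\<integral>\<^sup>+Z. f Z \<partial>PiM I M) = (\<integral>\<^sup>+Y. \<integral>\<^sup>+x. f (Y(k := x)) \<partial>M k \<partial>PiM (I - {k}) M)"
proof -
  let ?P = "PiM (I - {k}) M"
  interpret Mk: prob_space "M k" using M k .
  interpret P: prob_space ?P using M by (intro prob_space_PiM) auto
  interpret pair_sigma_finite "M k" ?P ..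
  have I: "insert k (I - {k}) = I" using k by auto
  have upd: "(\<lambda>(x, Y). Y(k := x)) \<in> M k \<Otimes>\<^sub>M ?P \<rightarrow>\<^sub>M PiM I M"
    using measurable_add_dim[of k "I - {k}" M, unfolded I]
    by (auto simp: measurable_pair_swap_iff[of _ "M k"] case_prod_beta)
  have "PiM I M = distr (M k \<Otimes>\<^sub>M ?P) (PiM I M) (\<lambda>(x, Y). Y(k := x))"
    using distr_pair_PiM_eq_PiM[of "I - {k}" M k, unfolded I] M k by simp
  then have "(\<integral>\<^sup>+Z. f Z \<partial>PiM I M)
    = (\<integral>\<^sup>+Z. f Z \<partial>distr (M k \<Otimes>\<^sub>M ?P) (PiM I M) (\<lambda>(x, Y). Y(k := x)))"
    by (rule arg_cong)
  also have "\<dots> = (\<integral>\<^sup>+(x, Y). f (Y(k := x)) \<partial>(M k \<Otimes>\<^sub>M ?P))"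
    using nn_integral_distr[OF upd, of f] f by (simp add: case_prod_unfold)
  also have "\<dots> = (\<integral>\<^sup>+Y. \<integral>\<^sup>+x. f (Y(k := x)) \<partial>M k \<partial>?P)"
    using measurable_compose[OF upd f]
    by (subst nn_integral_snd[symmetric]) (auto simp: case_prod_beta)
  finally show ?thesis .
qed

text \<open>With the other coordinates held fixed, only a one-dimensional translation remains. The
  cost is therefore independent of how many coordinates there are.\<close>

lemma nn_integral_PiM_laplace_shift_le:
  fixes I :: "'i set"
  assumes b: "b > 0" and k: "k \<in> I"
    and f [measurable]: "f \<in> borel_measurable (PiM I (\<lambda>_. laplace b))"
  shows "(\<integral>\<^sup>+Z. f (Z(k := Z k + c)) \<partial>PiM I (\<lambda>_. laplace b))
    \<le> exp (\<bar>c\<bar> / b) * (\<integral>\<^sup>+Z. f Z \<partial>PiM I (\<lambda>_. laplace b))"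
proof -
  let ?L = "\<lambda>_ :: 'i. laplace b"
  let ?P = "PiM (I - {k}) ?L"
  have I: "insert k (I - {k}) = I" using k by auto
  have L: "prob_space (?L i)" for i :: 'i using prob_space_laplace[OF b] .
  interpret Lk: prob_space "laplace b" using L .
  interpret P: prob_space ?P using L by (intro prob_space_PiM)
  interpret pair_sigma_finite ?P "laplace b" ..
  have shift: "(\<lambda>Z. Z(k := Z k + c)) \<in> PiM I ?L \<rightarrow>\<^sub>M PiM I ?L"
    using k by (intro measurable_fun_upd[where J = I]) auto
  have upd: "(\<lambda>(Y, x). Y(k := x)) \<in> ?P \<Otimes>\<^sub>M laplace b \<rightarrow>\<^sub>M PiM I ?L"
    using measurable_add_dim[of k "I - {k}" ?L, unfolded I] .
  note [measurable] = measurable_compose[OF upd f, unfolded case_prod_beta]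
  have f_upd: "(\<lambda>x. f (Y(k := x))) \<in> borel_measurable borel" if "Y \<in> space ?P" for Y
    using measurable_compose[OF measurable_Pair1'[OF that] measurable_compose[OF upd f]] by simp
  have "(\<integral>\<^sup>+Z. f (Z(k := Z k + c)) \<partial>PiM I ?L)
    = (\<integral>\<^sup>+Y. \<integral>\<^sup>+x. f (Y(k := x + c)) \<partial>laplace b \<partial>?P)"
    using nn_integral_PiM_insert[of I ?L, OF L k measurable_compose[OF shift f]] by simp
  also have "\<dots> \<le> (\<integral>\<^sup>+Y. exp (\<bar>c\<bar> / b) * (\<integral>\<^sup>+x. f (Y(k := x)) \<partial>laplace b) \<partial>?P)"
    by (intro nn_integral_mono nn_integral_laplace_shift_le[OF b] f_upd)
  also have "\<dots> = exp (\<bar>c\<bar> / b) * (\<integral>\<^sup>+Y. \<integral>\<^sup>+x. f (Y(k := x)) \<partial>laplace b \<partial>?P)"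
    by (intro nn_integral_cmult Lk.borel_measurable_nn_integral) (simp add: case_prod_beta)
  also have "\<dots> = exp (\<bar>c\<bar> / b) * (\<integral>\<^sup>+Z. f Z \<partial>PiM I ?L)"
    using nn_integral_PiM_insert[of I ?L, OF L k f] by simp
  finally show ?thesis .
qed

text \<open>By independence the two translations can be carried out one inside the other, so their
  costs multiply.\<close>

lemma nn_integral_laplace_pair_shift_le:
  fixes I :: "'i set" and a b c d :: real
  defines "N \<equiv> laplace a \<Otimes>\<^sub>M PiM I (\<lambda>_. laplace b)"
  assumes a: "a > 0" and b: "b > 0" and k: "k \<in> I" and f: "f \<in> borel_measurable N"
  shows "(\<integral>\<^sup>+(W, Z). f (W + c, Z(k := Z k + d)) \<partial>N)
    \<le> exp (\<bar>c\<bar> / a + \<bar>d\<bar> / b) * (\<integral>\<^sup>+w. f w \<partial>N)"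
proof -
  let ?P = "PiM I (\<lambda>_ :: 'i. laplace b)"
  interpret La: prob_space "laplace a" using prob_space_laplace[OF a] .
  interpret Q: prob_space ?P using prob_space_laplace[OF b] by (intro prob_space_PiM)
  have f' [measurable]: "f \<in> borel_measurable (laplace a \<Otimes>\<^sub>M ?P)" using f unfolding N_def .
  have [measurable]: "(\<lambda>Z. Z(k := Z k + d)) \<in> ?P \<rightarrow>\<^sub>M ?P"
    using k by (intro measurable_fun_upd[where J = I]) auto
  have int_f [measurable]: "(\<lambda>W. \<integral>\<^sup>+Z. f (W, Z) \<partial>?P) \<in> borel_measurable borel"
    using Q.borel_measurable_nn_integral_fst[OF f'] by simp
  have "(\<integral>\<^sup>+(W, Z). f (W + c, Z(k := Z k + d)) \<partial>N)
    = (\<integral>\<^sup>+W. \<integral>\<^sup>+Z. f (W + c, Z(k := Z k + d)) \<partial>?P \<partial>laplace a)"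
    unfolding N_def by (subst Q.nn_integral_fst[symmetric]) auto
  also have "\<dots> \<le> (\<integral>\<^sup>+W. exp (\<bar>d\<bar> / b) * (\<integral>\<^sup>+Z. f (W + c, Z) \<partial>?P) \<partial>laplace a)"
    by (intro nn_integral_mono nn_integral_PiM_laplace_shift_le[OF b k]) simp
  also have "\<dots> = exp (\<bar>d\<bar> / b) * (\<integral>\<^sup>+W. \<integral>\<^sup>+Z. f (W + c, Z) \<partial>?P \<partial>laplace a)"
    by (intro nn_integral_cmult) measurable
  also have "\<dots> \<le> exp (\<bar>d\<bar> / b) * (exp (\<bar>c\<bar> / a) * (\<integral>\<^sup>+W. \<integral>\<^sup>+Z. f (W, Z) \<partial>?P \<partial>laplace a))"
    by (intro mult_left_mono nn_integral_laplace_shift_le[OF a] int_f) simp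
  also have "\<dots> = exp (\<bar>c\<bar> / a + \<bar>d\<bar> / b) * (\<integral>\<^sup>+w. f w \<partial>N)"
    unfolding N_def by (subst Q.nn_integral_fst[OF f'])
      (simp add: exp_add ennreal_mult' ac_simps)
  finally show ?thesis .
qed

section \<open>The offline stage: argmax of noisy scores\<close>

text \<open>This is the report-noisy-max mechanism, with arbitrary scores \<open>s\<close> in place
  of the log-likelihood sums.\<close>

definition noisy_argmax ::
  "(nat set \<Rightarrow> nat) \<Rightarrow> (nat \<Rightarrow> real) \<Rightarrow> nat set \<Rightarrow> real \<Rightarrow> nat measure" where
  "noisy_argmax tie s I b =
    distr (\<Pi>\<^sub>M k\<in>I. laplace b) (count_space UNIV)
      (\<lambda>Z. tie {k. is_arg_max (\<lambda>k. s k + Z k) (\<lambda>k. k \<in> I) k})"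

lemma offline_pcpd_eq_noisy_argmax:
  "offline_pcpd tie y p0 p1 \<epsilon> n = noisy_argmax tie (\<lambda>k. llr_sum p0 p1 y k n) {1..n}
    (real_of_ereal (sensitivity p0 p1) / \<epsilon>)"
  by (simp add: offline_pcpd_def noisy_argmax_def)

text \<open>The set of maximisers takes only finitely many values, the subsets of \<open>I\<close>,
  and each is attained on a measurable event. Hence an arbitrary rule \<open>tie\<close> applied to
  it is measurable.\<close>

lemma measurable_tie_argmax:
  fixes s :: "nat \<Rightarrow> real" and tie :: "nat set \<Rightarrow> nat"
  assumes "finite I"
  shows "(\<lambda>Z. tie {k. is_arg_max (\<lambda>k. s k + Z k) (\<lambda>k. k \<in> I) k})
    \<in> (\<Pi>\<^sub>M k\<in>I. laplace b) \<rightarrow>\<^sub>M count_space UNIV"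
proof -
  let ?P = "\<Pi>\<^sub>M k\<in>I. laplace b"
  let ?K = "\<lambda>Z. {k. is_arg_max (\<lambda>k. s k + Z k) (\<lambda>k. k \<in> I) k}"
  have "Measurable.pred ?P (\<lambda>Z. k \<in> I \<and> (\<forall>l\<in>I. s l + Z l \<le> s k + Z k))" for k
  proof (cases "k \<in> I")
    case True
    have "{Z \<in> space ?P. s l + Z l \<le> s k + Z k} \<in> sets ?P" if "l \<in> I" for l
      using that True by measurable
    then show ?thesis
      using assms True by (intro pred_intros_logic pred_intros_finite) (auto simp: pred_def)
  qed simp
  then have mem: "Measurable.pred ?P (\<lambda>Z. k \<in> ?K Z)" for k
    by (simp add: is_arg_max_def not_less Bex_def[symmetric] Ball_def[symmetric] cong: conj_cong)
  have "?K -` {K} \<inter> space ?P \<in> sets ?P" for K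
  proof -
    have "?K -` {K} \<inter> space ?P = {Z \<in> space ?P. \<forall>k. k \<in> ?K Z \<longleftrightarrow> k \<in> K}"
      by auto
    also have "\<dots> \<in> sets ?P"
      using mem by measurable
    finally show ?thesis .
  qed
  moreover have "?K Z \<subseteq> I" for Z :: "nat \<Rightarrow> real"
    by (auto simp: is_arg_max_def)
  ultimately have "?K \<in> ?P \<rightarrow>\<^sub>M count_space (Pow I)"
    using assms by (subst measurable_count_space_eq2) auto
  then show ?thesis
    by (rule measurable_compose) simp
qed

lemma prob_space_noisy_argmax:
  assumes "b > 0" "finite I"
  shows "prob_space (noisy_argmax tie s I b)"
  unfolding noisy_argmax_def using assms
  by (intro prob_space.prob_space_distr measurable_tie_argmax prob_space_PiM prob_space_laplace)

lemma sets_noisy_argmax [simp]: "sets (noisy_argmax tie s I b) = UNIV"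
  by (simp add: noisy_argmax_def)

text \<open>The hypothesis \<open>s\<close> bounds the spread of the score changes
  \<open>s' - s\<close>, not their size, since a change common to all scores leaves the argmax
  alone. Relative to \<open>k\<close>, every competitor gains at most \<open>A\<close>, which
  raising \<open>Z k\<close> alone compensates.\<close>

lemma emeasure_noisy_argmax_le:
  fixes s s' :: "nat \<Rightarrow> real"
  assumes b: "b > 0" and fin: "finite I" and ne: "I \<noteq> {}" and A: "A \<ge> 0"
    and tie: "\<And>K. K \<noteq> {} \<Longrightarrow> K \<subseteq> I \<Longrightarrow> tie K \<in> K"
    and s: "\<And>k l. k \<in> I \<Longrightarrow> l \<in> I \<Longrightarrow> s' l - s l \<le> s' k - s k + A"
  shows "emeasure (noisy_argmax tie s I b) {k} \<le> exp (A / b) * emeasure (noisy_argmax tie s' I b) {k}"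
proof -
  let ?P = "\<Pi>\<^sub>M k\<in>I. laplace b"
  let ?K = "\<lambda>s Z. {k. is_arg_max (\<lambda>k. s k + Z k :: real) (\<lambda>k. k \<in> I) k}"
  let ?E = "\<lambda>s. {Z \<in> space ?P. tie (?K s Z) = k}"
  interpret prob_space ?P
    using prob_space_laplace[OF b] by (intro prob_space_PiM)
  have E [measurable]: "?E s \<in> sets ?P" for s
    using measurable_sets[OF measurable_tie_argmax[OF fin], of "{k}" tie s b]
    by (simp add: vimage_def Int_def conj_commute)
  have em: "emeasure (noisy_argmax tie s I b) {k} = emeasure ?P (?E s)" for s
    unfolding noisy_argmax_def
    by (subst emeasure_distr[OF measurable_tie_argmax[OF fin]])
      (auto intro!: arg_cong[where f = "emeasure ?P"])
  have tie_in: "tie (?K s Z) \<in> ?K s Z" for s Z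
  proof (rule tie)
    let ?f = "\<lambda>k. s k + Z k"
    have "Max (?f ` I) \<in> ?f ` I"
      using fin ne by simp
    then obtain k where k: "k \<in> I" "Max (?f ` I) = ?f k"
      by blast
    have "?f l \<le> ?f k" if "l \<in> I" for l
      unfolding k(2)[symmetric] using fin that by (intro Max_ge) auto
    then have "\<exists>k\<in>I. \<forall>l\<in>I. ?f l \<le> ?f k"
      using k(1) by blast
    then show "?K s Z \<noteq> {}"
      by (auto simp: is_arg_max_def not_less)
  qed (auto simp: is_arg_max_def)
  show ?thesis
  proof (cases "k \<in> I")
    case False
    then have empty: "?E s = {}"
      using tie_in[of s] by (auto simp: is_arg_max_def)
    show ?thesis
      unfolding em[of s] empty by simp
  next
    case True
    txt \<open>The extra \<open>d > 0\<close> makes \<open>k\<close> the unique maximiser, so that the tie-breaking rule plays no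
      role; then \<open>d\<close> tends to \<open>0\<close>.\<close>
    have shifted: "prob (?E s) \<le> exp ((A + d) / b) * prob (?E s')" if d: "d > 0" for d
    proof -
      have "tie (?K s' (Z(k := Z k + (A + d)))) = k" if Z: "tie (?K s Z) = k" for Z
      proof -
        have max: "s l + Z l \<le> s k + Z k" if "l \<in> I" for l
          using tie_in[of s Z] that unfolding Z by (auto simp: is_arg_max_def not_less)
        have less: "s' l + Z l < s' k + (Z k + (A + d))" if "l \<in> I" for l
          using max[OF that] s[OF True that] d by linarith
        have "?K s' (Z(k := Z k + (A + d))) = {k}"
        proof (intro equalityI subsetI)
          fix l assume l: "l \<in> ?K s' (Z(k := Z k + (A + d)))"
          then have "l \<in> I" and "\<not> (l \<noteq> k \<and> s' l + Z l < s' k + (Z k + (A + d)))"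
            using True by (auto simp: is_arg_max_def)
          then show "l \<in> {k}"
            using less by blast
        next
          fix l assume "l \<in> {k}"
          then show "l \<in> ?K s' (Z(k := Z k + (A + d)))"
            using True less by (auto simp: is_arg_max_def dest: less_asym)
        qed
        then show ?thesis
          using tie[of "{k}"] True by simp
      qed
      moreover have "Z(k := Z k + (A + d)) \<in> space ?P" if "Z \<in> space ?P" for Z
        using that True by (auto simp: space_PiM PiE_iff extensional_def)
      \<comment> \<open>The translation maps \<open>?E s\<close> into \<open>?E s'\<close>, so the
        indicator of the former is at most that of the latter composed with the translation.\<close>
      ultimately have "emeasure ?P (?E s)
        \<le> (\<integral>\<^sup>+Z. indicator (?E s') (Z(k := Z k + (A + d))) \<partial>?P)"
        by (subst nn_integral_indicator[symmetric, OF E])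
          (intro nn_integral_mono, auto split: split_indicator)
      also have "\<dots> \<le> exp (\<bar>A + d\<bar> / b) * (\<integral>\<^sup>+Z. indicator (?E s') Z \<partial>?P)"
        by (intro nn_integral_PiM_laplace_shift_le b True) measurable
      also have "\<dots> = exp ((A + d) / b) * emeasure ?P (?E s')"
        using A d by simp
      finally show ?thesis
        by (simp add: emeasure_eq_measure flip: ennreal_mult)
    qed
    have "((\<lambda>d. exp ((A + d) / b) * prob (?E s')) \<longlongrightarrow> exp ((A + 0) / b) * prob (?E s')) (at_right 0)"
      using b by (intro tendsto_intros) auto
    moreover have "\<forall>\<^sub>F d in at_right 0. prob (?E s) \<le> exp ((A + d) / b) * prob (?E s')"
      using shifted by (rule eventually_mono[OF eventually_at_right_less])
    ultimately have "prob (?E s) \<le> exp ((A + 0) / b) * prob (?E s')"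
      by (rule tendsto_lowerbound) simp
    then show ?thesis
      unfolding em by (simp add: emeasure_eq_measure flip: ennreal_mult)
  qed
qed

section \<open>The time of the first alarm\<close>

text \<open>The value is the halting time, with \<open>None\<close> for a run that never halts. The
  type \<open>nat option\<close> is countable, so the comparison on singletons applies to its
  law.\<close>

definition first_crossing ::
  "nat \<Rightarrow> (nat \<Rightarrow> real) \<Rightarrow> real \<Rightarrow> real \<times> (nat \<Rightarrow> real) \<Rightarrow> nat option" where
  "first_crossing n g T = (\<lambda>(W, Z).
    if \<exists>j. n \<le> j \<and> g j + Z j > T + W then Some (LEAST j. n \<le> j \<and> g j + Z j > T + W) else None)"

lemma first_crossing_eq_None_iff:
  "first_crossing n g T (W, Z) = None \<longleftrightarrow> (\<forall>i\<ge>n. g i + Z i \<le> T + W)"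
  by (auto simp: first_crossing_def not_less)

lemma first_crossing_eq_Some_iff:
  "first_crossing n g T (W, Z) = Some j
    \<longleftrightarrow> n \<le> j \<and> g j + Z j > T + W \<and> (\<forall>i. n \<le> i \<longrightarrow> i < j \<longrightarrow> g i + Z i \<le> T + W)"
  (is "_ \<longleftrightarrow> ?R")
proof
  let ?F = "\<lambda>j. n \<le> j \<and> g j + Z j > T + W"
  assume "first_crossing n g T (W, Z) = Some j"
  then have "\<exists>j. ?F j" and j: "j = (LEAST j. ?F j)"
    by (auto simp: first_crossing_def split: if_splits)
  then have "?F j"
    by (metis (no_types, lifting) LeastI_ex)
  moreover have "\<not> ?F i" if "i < j" for i
    using not_less_Least[of i ?F] that unfolding j by blast
  ultimately show ?R
    by (auto simp: not_less)
next
  assume ?R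
  then show "first_crossing n g T (W, Z) = Some j"
    by (auto simp: first_crossing_def intro!: Least_equality)
qed

lemma measurable_first_crossing:
  "first_crossing n g T \<in> laplace a \<Otimes>\<^sub>M (\<Pi>\<^sub>M j\<in>{n..}. laplace b) \<rightarrow>\<^sub>M count_space UNIV"
proof -
  let ?N = "laplace a \<Otimes>\<^sub>M (\<Pi>\<^sub>M j\<in>{n..}. laplace b)"
  \<comment> \<open>For \<open>j < n\<close> the coordinate \<open>j\<close> is not part of the
    product; the guard then makes the predicate constantly false.\<close>
  have [measurable]: "Measurable.pred ?N (\<lambda>w. n \<le> j \<and> T + fst w < g j + snd w j)" for j
  proof (cases "n \<le> j")
    case True
    then have [measurable]: "(\<lambda>w. snd w j) \<in> borel_measurable ?N"
      using measurable_compose[OF measurable_snd measurable_component_singleton[of j "{n..}" "\<lambda>_. laplace b"]]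
      by simp
    have [measurable]: "fst \<in> borel_measurable ?N"
      using measurable_fst[of "laplace a"] by simp
    show ?thesis
      by measurable
  qed simp
  show ?thesis
    unfolding first_crossing_def case_prod_beta by measurable
qed

text \<open>Raising the threshold by \<open>A\<close> keeps all earlier times silent, since
  \<open>g'\<close> exceeds \<open>g\<close> by at most \<open>A\<close>. At the alarm itself
  \<open>g'\<close> may be lower by \<open>A\<close> while the threshold is higher by
  \<open>A\<close>, hence the shift \<open>2 * A\<close> of its noise.\<close>

lemma emeasure_first_crossing_le:
  fixes a b A :: real and n :: nat
  defines "N \<equiv> laplace a \<Otimes>\<^sub>M (\<Pi>\<^sub>M j\<in>{n..}. laplace b)"
  assumes a: "a > 0" and b: "b > 0" and A: "A \<ge> 0"
    and g: "\<And>j. j \<ge> n \<Longrightarrow> \<bar>g' j - g j\<bar> \<le> A"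
  shows "emeasure (distr N (count_space UNIV) (first_crossing n g T)) {r}
    \<le> exp (A / a + 2 * A / b) * emeasure (distr N (count_space UNIV) (first_crossing n g' T)) {r}"
proof -
  let ?E = "\<lambda>g. {w \<in> space N. first_crossing n g T w = r}"
  have meas: "first_crossing n g T \<in> N \<rightarrow>\<^sub>M count_space UNIV" for g
    unfolding N_def by (rule measurable_first_crossing)
  have E [measurable]: "?E g \<in> sets N" for g
    using measurable_sets[OF meas, of "{r}" g] by (simp add: vimage_def Int_def conj_commute)
  have em: "emeasure (distr N (count_space UNIV) (first_crossing n g T)) {r} = emeasure N (?E g)" for g
    by (subst emeasure_distr[OF meas]) (auto intro!: arg_cong[where f = "emeasure N"])
  \<comment> \<open>One translation suits all outcomes \<open>r\<close>. For \<open>Some j\<close>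
    with \<open>n \<le> j\<close> it takes \<open>k = j\<close> and \<open>d = 2 * A\<close>. For
    \<open>None\<close> only the threshold has to move, so \<open>d = 0\<close> with the dummy index
    \<open>n\<close>; this also serves \<open>j < n\<close>, an outcome that never occurs.\<close>
  obtain k d where k: "k \<ge> n" and d: "0 \<le> d" "d \<le> 2 * A"
    and shift: "\<And>W Z. first_crossing n g T (W, Z) = r
      \<Longrightarrow> first_crossing n g' T (W + A, Z(k := Z k + d)) = r"
  proof (cases r)
    case None
    have "first_crossing n g' T (W + A, Z(n := Z n + 0)) = r"
      if "first_crossing n g T (W, Z) = r" for W Z
      using that g unfolding None first_crossing_eq_None_iff by simp (smt (verit))
    then show ?thesis
      using A that[of n 0] by simp
  next
    case (Some j)
    show ?thesis
    proof (cases "n \<le> j")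
      case True
      have "first_crossing n g' T (W + A, Z(j := Z j + 2 * A)) = r"
        if "first_crossing n g T (W, Z) = r" for W Z
        using that g unfolding Some first_crossing_eq_Some_iff by simp (smt (verit))
      then show ?thesis
        using A True that[of j "2 * A"] by simp
    next
      case False
      then have "first_crossing n g T (W, Z) \<noteq> r" for W Z
        unfolding Some first_crossing_eq_Some_iff by simp
      then show ?thesis
        using A that[of n 0] by simp
    qed
  qed
  have "(W + A, Z(k := Z k + d)) \<in> space N" if "(W, Z) \<in> space N" for W Z
    using that k by (auto simp: N_def space_pair_measure space_PiM PiE_iff extensional_def)
  then have "emeasure N (?E g) \<le> (\<integral>\<^sup>+(W, Z). indicator (?E g') (W + A, Z(k := Z k + d)) \<partial>N)"
    using shift by (subst nn_integral_indicator[symmetric, OF E])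
      (intro nn_integral_mono, auto split: split_indicator)
  also have "\<dots> \<le> exp (\<bar>A\<bar> / a + \<bar>d\<bar> / b) * (\<integral>\<^sup>+w. indicator (?E g') w \<partial>N)"
    unfolding N_def using k
    by (intro nn_integral_laplace_pair_shift_le a b) (auto intro!: borel_measurable_indicator E[unfolded N_def])
  also have "\<dots> \<le> exp (A / a + 2 * A / b) * emeasure N (?E g')"
    using A b d by (auto intro!: mult_right_mono divide_right_mono)
  finally show ?thesis
    unfolding em .
qed

section \<open>Sensitivity and the effect of one changed data point\<close>

lemma llr_diff_le_sensitivity:
  assumes "sensitivity p0 p1 < \<infinity>"
  shows "\<bar>real_of_ereal (llr p0 p1 a) - real_of_ereal (llr p0 p1 b)\<bar>
    \<le> real_of_ereal (sensitivity p0 p1)"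
proof -
  let ?S = "SUP x. llr p0 p1 x" and ?I = "INF x. llr p0 p1 x"
  have bounds: "?I \<le> llr p0 p1 x" "llr p0 p1 x \<le> ?S" for x
    by (auto intro: INF_lower SUP_upper)
  have "?S - ?I < \<infinity>"
    using assms by (simp add: sensitivity_def)
  moreover have "?I \<le> ?S"
    using bounds[of 0] by (rule order_trans)
  \<comment> \<open>In \<open>ereal\<close> both \<open>\<infinity> - \<infinity>\<close> and
    \<open>-\<infinity> - -\<infinity>\<close> are \<open>\<infinity>\<close>, so the bound on the
    difference excludes \<open>?S = \<infinity>\<close> and \<open>?I = -\<infinity>\<close>. The
    order \<open>?I \<le> ?S\<close> then excludes \<open>?S = -\<infinity>\<close> and
    \<open>?I = \<infinity>\<close>.\<close>
  ultimately obtain s i where si: "?S = ereal s" "?I = ereal i"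
    by (cases ?S; cases ?I) auto
  have "\<exists>r. llr p0 p1 x = ereal r \<and> i \<le> r \<and> r \<le> s" for x
    using bounds[of x] unfolding si by (cases "llr p0 p1 x") auto
  then obtain ra rb where "llr p0 p1 a = ereal ra" "i \<le> ra" "ra \<le> s"
    and "llr p0 p1 b = ereal rb" "i \<le> rb" "rb \<le> s"
    by metis
  then show ?thesis
    by (simp add: sensitivity_def si)
qed

text \<open>The position \<open>i\<close> and its effect \<open>d\<close> are fixed before
  \<open>k\<close> and \<open>j\<close>. The window maxima need only the size of \<open>d\<close>,
  while the offline stage relies on \<open>d\<close> being common to all affected sums. The
  restriction \<open>k \<ge> 1\<close> reflects that \<open>neighboring\<close> leaves entry 0
  free.\<close>

lemma neighboring_llr_sum:
  assumes "sensitivity p0 p1 < \<infinity>" and "neighboring X X'"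
  obtains i d where "\<bar>d\<bar> \<le> real_of_ereal (sensitivity p0 p1)"
    and "\<And>k j. k \<ge> 1
      \<Longrightarrow> llr_sum p0 p1 X' k j = llr_sum p0 p1 X k j + (if k \<le> i \<and> i \<le> j then d else 0)"
proof -
  obtain i where i: "\<And>m. m \<ge> 1 \<Longrightarrow> m \<noteq> i \<Longrightarrow> X m = X' m"
    using assms(2) by (auto simp: neighboring_def)
  let ?l = "\<lambda>X m. real_of_ereal (llr p0 p1 (X m))"
  let ?d = "?l X' i - ?l X i"
  have "llr_sum p0 p1 X' k j = llr_sum p0 p1 X k j + (if k \<le> i \<and> i \<le> j then ?d else 0)"
    if "k \<ge> 1" for k j
  proof -
    have "llr_sum p0 p1 X' k j = (\<Sum>m=k..j. ?l X m + (if m = i then ?d else 0))"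
      unfolding llr_sum_def using i that by (intro sum.cong) auto
    also have "\<dots> = llr_sum p0 p1 X k j + (if k \<le> i \<and> i \<le> j then ?d else 0)"
      by (simp add: llr_sum_def sum.distrib sum.delta)
    finally show ?thesis .
  qed
  then show thesis
    by (rule that[OF llr_diff_le_sensitivity[OF assms(1)]])
qed

lemma Max_image_diff_le:
  fixes f g :: "'a \<Rightarrow> real"
  assumes "finite K" "K \<noteq> {}" "\<And>k. k \<in> K \<Longrightarrow> \<bar>f k - g k\<bar> \<le> A"
  shows "\<bar>Max (f ` K) - Max (g ` K)\<bar> \<le> A"
proof -
  have "Max (f ` K) \<le> Max (g ` K) + A" if "\<And>k. k \<in> K \<Longrightarrow> \<bar>f k - g k\<bar> \<le> A" for f g :: "'a \<Rightarrow> real"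
  proof -
    have "f k \<le> Max (g ` K) + A" if k: "k \<in> K" for k
    proof -
      have "g k \<le> Max (g ` K)"
        using assms(1) k by (intro Max_ge) auto
      then show ?thesis
        using \<open>\<And>k. k \<in> K \<Longrightarrow> \<bar>f k - g k\<bar> \<le> A\<close>[OF k] by linarith
    qed
    then show ?thesis
      using assms(1,2) by simp
  qed
  from this[of f g] this[of g f] show ?thesis
    using assms(3) by (fastforce simp: abs_le_iff abs_minus_commute)
qed

text \<open>A maximum moves no more than its entries do. The bounds on \<open>n\<close> and
  \<open>j\<close> make the window nonempty.\<close>

lemma window_max_neighboring:
  assumes "sensitivity p0 p1 < \<infinity>" and "neighboring X X'" and "n \<ge> 1" and "j \<ge> n"
  shows "\<bar>window_max p0 p1 n X' j - window_max p0 p1 n X j\<bar> \<le> real_of_ereal (sensitivity p0 p1)"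
proof -
  obtain i d where "\<bar>d\<bar> \<le> real_of_ereal (sensitivity p0 p1)"
    and "\<And>k j. k \<ge> 1
      \<Longrightarrow> llr_sum p0 p1 X' k j = llr_sum p0 p1 X k j + (if k \<le> i \<and> i \<le> j then d else 0)"
    by (rule neighboring_llr_sum[OF assms(1,2)]) (rule that)
  then show ?thesis
    unfolding window_max_def using assms(3,4) by (intro Max_image_diff_le) auto
qed

lemma neighboring_shift:
  assumes "neighboring X X'"
  shows "neighboring (\<lambda>i. X (m + i)) (\<lambda>i. X' (m + i))"
proof -
  obtain j where j: "\<forall>i\<ge>1. i \<noteq> j \<longrightarrow> X i = X' i"
    using assms by (auto simp: neighboring_def)
  \<comment> \<open>For \<open>j \<le> m\<close> the truncated difference is 0, which is harmless:
    the changed entry then lies before the shifted stream's position 1.\<close>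
  then show ?thesis
    unfolding neighboring_def by (intro exI[of _ "j - m"]) auto
qed

text \<open>The scale \<open>A / \<epsilon>\<close> (rather than \<open>2 * A / \<epsilon>\<close>) suffices because changing one data point moves all
  affected partial sums by the same amount.\<close>

lemma offline_pcpd_le:
  assumes fin: "sensitivity p0 p1 < \<infinity>" and pos: "real_of_ereal (sensitivity p0 p1) > 0"
    and nb: "neighboring y y'" and "\<epsilon> > 0" "n \<ge> 1"
    and tie: "\<And>K. K \<noteq> {} \<Longrightarrow> K \<subseteq> {1..n} \<Longrightarrow> tie K \<in> K"
  shows "emeasure (offline_pcpd tie y p0 p1 \<epsilon> n) {k}
    \<le> exp \<epsilon> * emeasure (offline_pcpd tie y' p0 p1 \<epsilon> n) {k}"
proof -
  let ?A = "real_of_ereal (sensitivity p0 p1)"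
  obtain i d where d: "\<bar>d\<bar> \<le> ?A"
    and sum: "\<And>k j. k \<ge> 1
      \<Longrightarrow> llr_sum p0 p1 y' k j = llr_sum p0 p1 y k j + (if k \<le> i \<and> i \<le> j then d else 0)"
    by (rule neighboring_llr_sum[OF fin nb]) (rule that)
  have "emeasure (offline_pcpd tie y p0 p1 \<epsilon> n) {k}
    \<le> exp (?A / (?A / \<epsilon>)) * emeasure (offline_pcpd tie y' p0 p1 \<epsilon> n) {k}"
    unfolding offline_pcpd_eq_noisy_argmax
  proof (rule emeasure_noisy_argmax_le)
    show "llr_sum p0 p1 y' l n - llr_sum p0 p1 y l n
      \<le> llr_sum p0 p1 y' k n - llr_sum p0 p1 y k n + ?A" if "k \<in> {1..n}" "l \<in> {1..n}" for k l
      using that d by (auto simp: sum)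
  qed (use assms(2,4,5) tie in simp_all)
  then show ?thesis
    using pos \<open>\<epsilon> > 0\<close> by simp
qed

section \<open>Composition of the alarm with the offline stage\<close>

definition halting_output ::
  "(nat set \<Rightarrow> nat) \<Rightarrow> (nat \<Rightarrow> real) \<Rightarrow> (real \<Rightarrow> real) \<Rightarrow> (real \<Rightarrow> real) \<Rightarrow> real \<Rightarrow> nat \<Rightarrow> nat option
    \<Rightarrow> transcript measure" where
  "halting_output tie x p0 p1 \<epsilon> n r =
    (case r of
      None \<Rightarrow> return (count_space UNIV) (endless_transcript n)
    | Some j \<Rightarrow> offline_pcpd tie (\<lambda>i. x (j - n + i)) p0 p1 \<epsilon> n \<bind>
        (\<lambda>k. return (count_space UNIV) (halted_transcript n j (k + (j - n)))))"

text \<open>The noise of the alarm influences the output only through the halting time. This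
  factorisation lets the two stages be compared separately.\<close>

lemma online_pcpd_eq_bind:
  fixes p0 p1 :: "real \<Rightarrow> real"
  defines "A \<equiv> real_of_ereal (sensitivity p0 p1)"
  shows "online_pcpd tie x p0 p1 \<epsilon> n T =
    (laplace (4 * A / \<epsilon>) \<Otimes>\<^sub>M (\<Pi>\<^sub>M j\<in>{n..}. laplace (8 * A / \<epsilon>))) \<bind>
      (\<lambda>w. halting_output tie x p0 p1 (\<epsilon> / 2) n (first_crossing n (window_max p0 p1 n x) T w))"
  unfolding online_pcpd_def A_def Let_def
proof (rule arg_cong2[where f = bind, OF refl], rule ext, goal_cases)
  case (1 w)
  show ?case
    by (cases w; cases "\<exists>j. n \<le> j \<and> T + fst w < window_max p0 p1 n x j + snd w j";
        simp only: prod.case fst_conv snd_conv halting_output_def first_crossing_def if_True if_False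
          option.case)
qed

lemma prob_space_offline_pcpd:
  assumes "real_of_ereal (sensitivity p0 p1) > 0" and "\<epsilon> > 0"
  shows "prob_space (offline_pcpd tie y p0 p1 \<epsilon> n)"
  unfolding offline_pcpd_eq_noisy_argmax using assms
  by (intro prob_space_noisy_argmax) auto

lemma sets_offline_pcpd [simp]: "sets (offline_pcpd tie y p0 p1 \<epsilon> n) = UNIV"
  by (simp add: offline_pcpd_eq_noisy_argmax)

lemma measurable_return_halted:
  "(\<lambda>k. return (count_space UNIV) (halted_transcript n j (k + m)))
    \<in> offline_pcpd tie y p0 p1 \<epsilon> n \<rightarrow>\<^sub>M subprob_algebra (count_space UNIV)"
  by (rule measurable_compose[OF _ return_measurable]) (simp add: measurable_def)

lemma halting_output_kernel:
  assumes "real_of_ereal (sensitivity p0 p1) > 0" and "\<epsilon> > 0"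
  shows "halting_output tie x p0 p1 \<epsilon> n
    \<in> count_space UNIV \<rightarrow>\<^sub>M subprob_algebra (count_space UNIV)"
proof -
  have "halting_output tie x p0 p1 \<epsilon> n r \<in> space (subprob_algebra (count_space UNIV))" for r
  proof (cases r)
    case None
    then show ?thesis
      by (simp add: halting_output_def space_subprob_algebra prob_space_imp_subprob_space
          prob_space_return)
  next
    case (Some j)
    let ?O = "offline_pcpd tie (\<lambda>i. x (j - n + i)) p0 p1 \<epsilon> n"
    interpret O: prob_space ?O using prob_space_offline_pcpd[OF assms] .
    show ?thesis
      unfolding space_subprob_algebra Some halting_output_def option.case mem_Collect_eq
      by (intro conjI subprob_space_bind[OF O.subprob_space_axioms measurable_return_halted]
          sets_bind[OF sets_kernel[OF measurable_return_halted] O.not_empty])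
  qed
  then show ?thesis
    by simp
qed

text \<open>At a fixed halting time the transcript is either constant or obtained from the offline
  output by the map \<open>?R\<close>, which is the same for both streams.\<close>

lemma emeasure_halting_output_le:
  assumes fin: "sensitivity p0 p1 < \<infinity>" and pos: "real_of_ereal (sensitivity p0 p1) > 0"
    and nb: "neighboring x x'" and eps: "\<epsilon> > 0" and n: "n \<ge> 1"
    and tie: "\<And>K. K \<noteq> {} \<Longrightarrow> K \<subseteq> {1..n} \<Longrightarrow> tie K \<in> K"
  shows "emeasure (halting_output tie x p0 p1 \<epsilon> n r) S
    \<le> exp \<epsilon> * emeasure (halting_output tie x' p0 p1 \<epsilon> n r) S"
proof (cases r)
  case None
  have "1 * emeasure (halting_output tie x p0 p1 \<epsilon> n r) S
    \<le> ennreal (exp \<epsilon>) * emeasure (halting_output tie x p0 p1 \<epsilon> n r) S"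
    using eps by (intro mult_right_mono) (auto simp flip: ennreal_1 intro!: ennreal_leI)
  then show ?thesis
    using None by (simp add: halting_output_def)
next
  case (Some j)
  let ?R = "\<lambda>k. return (count_space UNIV) (halted_transcript n j (k + (j - n)))"
  let ?O = "\<lambda>x. offline_pcpd tie (\<lambda>i. x (j - n + i)) p0 p1 \<epsilon> n"
  have eq: "emeasure (halting_output tie x p0 p1 \<epsilon> n r) S = (\<integral>\<^sup>+k. emeasure (?R k) S \<partial>?O x)" for x
    unfolding halting_output_def Some option.case
    using prob_space.not_empty[OF prob_space_offline_pcpd[OF pos eps]]
    by (intro emeasure_bind[where N = "count_space UNIV"] measurable_return_halted) auto
  have "(\<integral>\<^sup>+k. emeasure (?R k) S \<partial>?O x) \<le> exp \<epsilon> * (\<integral>\<^sup>+k. emeasure (?R k) S \<partial>?O x')"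
    by (intro nn_integral_le_if_singletons_le sets_offline_pcpd
        offline_pcpd_le[OF fin pos neighboring_shift[OF nb] eps n tie])
  then show ?thesis
    unfolding eq .
qed

lemma emeasure_online_pcpd_le:
  assumes fin: "sensitivity p0 p1 < \<infinity>" and pos: "real_of_ereal (sensitivity p0 p1) > 0"
    and nb: "neighboring X X'" and eps: "\<epsilon> > 0" and n: "n \<ge> 1"
    and tie: "\<And>K. K \<noteq> {} \<Longrightarrow> K \<subseteq> {1..n} \<Longrightarrow> tie K \<in> K"
  shows "emeasure (online_pcpd tie X p0 p1 \<epsilon> n T) S
    \<le> exp \<epsilon> * emeasure (online_pcpd tie X' p0 p1 \<epsilon> n T) S"
proof -
  define A where "A = real_of_ereal (sensitivity p0 p1)"
  define N where "N = laplace (4 * A / \<epsilon>) \<Otimes>\<^sub>M (\<Pi>\<^sub>M j\<in>{n..}. laplace (8 * A / \<epsilon>))"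
  define D where "D = (\<lambda>x. distr N (count_space UNIV) (first_crossing n (window_max p0 p1 n x) T))"
  have A: "A > 0" using pos unfolding A_def .
  have eps2: "\<epsilon> / 2 > 0" using eps by simp
  let ?H = "\<lambda>x. halting_output tie x p0 p1 (\<epsilon> / 2) n"
  have eq: "emeasure (online_pcpd tie x p0 p1 \<epsilon> n T) S = (\<integral>\<^sup>+r. emeasure (?H x r) S \<partial>D x)" for x
  proof -
    have fc: "first_crossing n (window_max p0 p1 n x) T \<in> N \<rightarrow>\<^sub>M count_space UNIV"
      unfolding N_def by (rule measurable_first_crossing)
    have "space N \<noteq> {}"
      by (auto simp: N_def space_pair_measure space_PiM PiE_eq_empty_iff)
    then show ?thesis
      unfolding online_pcpd_eq_bind A_def[symmetric] N_def[symmetric] D_def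
      by (subst emeasure_bind[OF _ measurable_compose[OF fc halting_output_kernel[OF pos eps2]]])
        (auto simp: nn_integral_distr[OF fc])
  qed
  \<comment> \<open>Adaptive composition: first the kernel is exchanged at each fixed halting time,
    then the law of the halting time, each at the cost \<open>exp (\<epsilon> / 2)\<close>.\<close>
  have "emeasure (online_pcpd tie X p0 p1 \<epsilon> n T) S \<le> (\<integral>\<^sup>+r. exp (\<epsilon> / 2) * emeasure (?H X' r) S \<partial>D X)"
    unfolding eq by (intro nn_integral_mono emeasure_halting_output_le fin pos nb eps2 n tie)
  also have "\<dots> \<le> exp (\<epsilon> / 2) * (\<integral>\<^sup>+r. exp (\<epsilon> / 2) * emeasure (?H X' r) S \<partial>D X')"
  proof (rule nn_integral_le_if_singletons_le)
    fix r
    have "emeasure (D X) {r}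
      \<le> exp (A / (4 * A / \<epsilon>) + 2 * A / (8 * A / \<epsilon>)) * emeasure (D X') {r}"
      unfolding D_def N_def using A eps window_max_neighboring[OF fin nb n]
      by (intro emeasure_first_crossing_le) (auto simp: A_def)
    also have "A / (4 * A / \<epsilon>) + 2 * A / (8 * A / \<epsilon>) = \<epsilon> / 2"
      using A eps by (simp add: field_simps)
    finally show "emeasure (D X) {r} \<le> exp (\<epsilon> / 2) * emeasure (D X') {r}" .
  qed (simp_all add: D_def)
  also have "\<dots> = exp (\<epsilon> / 2) * (exp (\<epsilon> / 2) * emeasure (online_pcpd tie X' p0 p1 \<epsilon> n T) S)"
    unfolding eq by (subst nn_integral_cmult) (auto simp: D_def)
  also have "\<dots> = exp \<epsilon> * emeasure (online_pcpd tie X' p0 p1 \<epsilon> n T) S"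
    by (simp add: mult.assoc[symmetric] flip: ennreal_mult exp_add)
  finally show ?thesis .
qed

text \<open>Finiteness allows the bound for \<open>emeasure\<close> to be read as one for
  \<open>measure\<close>.\<close>

lemma subprob_space_online_pcpd:
  assumes "real_of_ereal (sensitivity p0 p1) > 0" and "\<epsilon> > 0"
  shows "subprob_space (online_pcpd tie X p0 p1 \<epsilon> n T)"
proof -
  let ?A = "real_of_ereal (sensitivity p0 p1)"
  let ?P = "\<Pi>\<^sub>M j\<in>{n..}. laplace (8 * ?A / \<epsilon>)"
  interpret L: prob_space "laplace (4 * ?A / \<epsilon>)"
    using assms by (intro prob_space_laplace) auto
  interpret Q: prob_space ?P
    using assms by (intro prob_space_PiM prob_space_laplace) auto
  interpret pair_prob_space "laplace (4 * ?A / \<epsilon>)" ?P ..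
  show ?thesis
    unfolding online_pcpd_eq_bind using assms
    by (intro subprob_space_bind[OF P.subprob_space_axioms, where N = "count_space UNIV"]
        measurable_compose[OF measurable_first_crossing halting_output_kernel]) auto
qed

text \<open>The stream enters the algorithm only through its log-likelihood sums, and these agree
  for any two streams when the ratio is constant. The translation bounds cannot cover this case
  because they require a positive scale.\<close>

lemma online_pcpd_eq_if_sensitivity_0:
  assumes "sensitivity p0 p1 < \<infinity>" and "real_of_ereal (sensitivity p0 p1) = 0"
  shows "online_pcpd tie X p0 p1 \<epsilon> n T = online_pcpd tie X' p0 p1 \<epsilon> n T"
proof -
  have "real_of_ereal (llr p0 p1 a) = real_of_ereal (llr p0 p1 b)" for a b
    using llr_diff_le_sensitivity[OF assms(1), of a b] assms(2) by simp
  then have sum: "llr_sum p0 p1 Y = llr_sum p0 p1 Y'" for Y Y'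
    unfolding llr_sum_def by (intro ext sum.cong) auto
  have wm: "window_max p0 p1 n X = window_max p0 p1 n X'"
    unfolding window_max_def sum[of X X'] ..
  have off: "offline_pcpd tie Y p0 p1 \<epsilon>' n = offline_pcpd tie Y' p0 p1 \<epsilon>' n" for Y Y' \<epsilon>'
    unfolding offline_pcpd_eq_noisy_argmax sum[of Y Y'] ..
  have "halting_output tie X p0 p1 (\<epsilon> / 2) n r = halting_output tie X' p0 p1 (\<epsilon> / 2) n r" for r
  proof (cases r)
    case (Some j)
    show ?thesis
      unfolding halting_output_def Some option.case
        off[of "\<lambda>i. X (j - n + i)" _ "\<lambda>i. X' (j - n + i)"] ..
  qed (simp add: halting_output_def)
  then show ?thesis
    unfolding online_pcpd_eq_bind wm by simp
qed

theorem theorem8: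
  fixes \<mu> :: "real measure"
    and p0 p1 :: "real \<Rightarrow> real"
    and tie :: "nat set \<Rightarrow> nat"
    and \<epsilon> T :: real
    and n :: nat
  assumes "sets \<mu> = sets borel"
    and "p0 \<in> borel_measurable \<mu>" and "\<And>x. 0 \<le> p0 x"
    and "prob_space (density \<mu> (\<lambda>x. ennreal (p0 x)))"
    and "p1 \<in> borel_measurable \<mu>" and "\<And>x. 0 \<le> p1 x"
    and "prob_space (density \<mu> (\<lambda>x. ennreal (p1 x)))"
    and "sensitivity p0 p1 < \<infinity>"
    and "\<And>K. K \<noteq> {} \<Longrightarrow> K \<subseteq> {1..n} \<Longrightarrow> tie K \<in> K"
    and "\<epsilon> > 0"
    and "n \<ge> 1"
  shows "differentially_private neighboring (\<lambda>X. online_pcpd tie X p0 p1 \<epsilon> n T) \<epsilon> 0"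
proof -
  let ?A = "real_of_ereal (sensitivity p0 p1)"
  let ?M = "\<lambda>X. online_pcpd tie X p0 p1 \<epsilon> n T"
  have "measure (?M X) S \<le> exp \<epsilon> * measure (?M X') S" if nb: "neighboring X X'" for X X' S
  proof (cases "?A = 0")
    case True
    then have "?M X = ?M X'"
      using assms(8) by (rule online_pcpd_eq_if_sensitivity_0[rotated])
    then show ?thesis
      using \<open>\<epsilon> > 0\<close> mult_right_mono[of 1 "exp \<epsilon>" "measure (?M X') S"] by simp
  next
    case False
    \<comment> \<open>At two equal points the bound by the sensitivity reads
      \<open>0 \<le> ?A\<close>.\<close>
    then have pos: "?A > 0"
      using llr_diff_le_sensitivity[OF assms(8), of 0 0] by simp
    interpret M: subprob_space "?M X" using subprob_space_online_pcpd[OF pos assms(10)] .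
    interpret M': subprob_space "?M X'" using subprob_space_online_pcpd[OF pos assms(10)] .
    have "emeasure (?M X) S \<le> exp \<epsilon> * emeasure (?M X') S"
      by (intro emeasure_online_pcpd_le assms(8-11) pos nb)
    then show ?thesis
      by (simp add: M.emeasure_eq_measure M'.emeasure_eq_measure flip: ennreal_mult)
  qed
  then show ?thesis
    by (simp add: differentially_private_def)
qed

end
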